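(* Let $\Phi_{a}=(\Delta_{a},\Gamma_{a})$ and $\Phi_{b}=(\Delta_{b},(\Delta_{a}\cap\Delta_{b})\cup\Gamma_{b})$ be partitionable relative simplicial complexes such that no facet of one is properly contained in a facet of the other, where $\Gamma_{b}$ is a subcomplex of $\Delta_{b}$. If $\Delta_{a}\cap\Gamma_{b}\subseteq\Gamma_{a}$, then the complex $\Phi=(\Delta_{a}\cup\Delta_{b},\Gamma_{a}\cup\Gamma_{b})$ is partitionable. Furthermore, if $\Phi_{a}$ and $\Phi_{b}$ are shellable, then $\Phi$ is also shellable.
   Context: A simplicial complex is a collection of subsets of a finite ground set closed under inclusion; the empty collection $\varnothing$ and the complex $\{\varnothing\}$ are distinct. The dimension of a face is its cardinality minus one. A relative simplicial complex $(\Delta,\Gamma)$ is a pair of simplicial complexes with $\Gamma$ a subcomplex of $\Delta$ ($\Gamma=\varnothing$ allowed, giving an ordinary complex). Its faces are the faces of $\Delta$ not in $\Gamma$, and its facets are the inclusion-maximal such faces. Unions and intersections of complexes are taken as set systems. $(\Delta,\Gamma)$ is partitionable if its set of faces $\Delta\setminus\Gamma$ is the disjoint union of intervals $[R(\sigma),\sigma]=\{\rho : R(\sigma)\subseteq\rho\subseteq\sigma\}$, one for each facet $\sigma$ of $(\Delta,\Gamma)$, with $R(\sigma)\subseteq\sigma$ a face of $(\Delta,\Gamma)$. Shellability: for a family of sets $\Lambda$, let $\langle\Lambda\rangle$ be the complex of all subsets of members of $\Lambda$. $(\Delta,\Gamma)$ is shellable if its facets can be ordered $\sigma_{1},\dots,\sigma_{m}$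 so that, writing $\Lambda_{j-1}=\Gamma\cup\langle\sigma_{1},\dots,\sigma_{j-1}\rangle$ (and $\Lambda_0=\Gamma$), the complex $\langle\sigma_{j}\rangle\cap\Lambda_{j-1}$ is pure of dimension $\dim\sigma_{j}-1$ (pure: all its facets have the same dimension) for every $j\ge 1$ if $\Gamma\neq\varnothing$, and for every $j>1$ if $\Gamma=\varnothing$. *)

theory Defs
  imports Main "HOL-Library.Disjoint_Sets"
begin

text \<open>The empty collection and the collection containing only the empty face are
  distinct, and both are complexes.\<close>

definition simplicial_complex :: "'a set set \<Rightarrow> bool" where
  "simplicial_complex \<Delta> \<longleftrightarrow>
     (\<exists>V. finite V \<and> \<Delta> \<subseteq> Pow V) \<and> (\<forall>\<sigma>\<in>\<Delta>. \<forall>\<tau>. \<tau> \<subseteq> \<sigma> \<longrightarrow> \<tau> \<in> \<Delta>)"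

definition relative_complex :: "'a set set \<Rightarrow> 'a set set \<Rightarrow> bool" where
  "relative_complex \<Delta> \<Gamma> \<longleftrightarrow>
     simplicial_complex \<Delta> \<and> simplicial_complex \<Gamma> \<and> \<Gamma> \<subseteq> \<Delta>"

text \<open>The dimension of a face is an integer; the empty face has dimension -1.\<close>

definition face_dim :: "'a set \<Rightarrow> int" where
  "face_dim \<sigma> = int (card \<sigma>) - 1"

definition faces :: "'a set set \<Rightarrow> 'a set set \<Rightarrow> 'a set set" where
  "faces \<Delta> \<Gamma> = \<Delta> - \<Gamma>"

definition facets :: "'a set set \<Rightarrow> 'a set set \<Rightarrow> 'a set set" where
  "facets \<Delta> \<Gamma> = {\<sigma> \<in> faces \<Delta> \<Gamma>. \<forall>\<tau> \<in> faces \<Delta> \<Gamma>. \<not> \<sigma> \<subset> \<tau>}"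

text \<open>Below, \<open>{R \<sigma>..\<sigma>}\<close> is the library's order interval for set inclusion.\<close>

definition partitionable :: "'a set set \<Rightarrow> 'a set set \<Rightarrow> bool" where
  "partitionable \<Delta> \<Gamma> \<longleftrightarrow>
     (\<exists>R. (\<forall>\<sigma> \<in> facets \<Delta> \<Gamma>. R \<sigma> \<subseteq> \<sigma> \<and> R \<sigma> \<in> faces \<Delta> \<Gamma>) \<and>
          disjoint_family_on (\<lambda>\<sigma>. {R \<sigma>..\<sigma>}) (facets \<Delta> \<Gamma>) \<and>
          faces \<Delta> \<Gamma> = (\<Union>\<sigma> \<in> facets \<Delta> \<Gamma>. {R \<sigma>..\<sigma>}))"

definition generated_complex :: "'a set set \<Rightarrow> 'a set set" where
  "generated_complex \<Lambda> = {\<tau>. \<exists>\<sigma>\<in>\<Lambda>. \<tau> \<subseteq> \<sigma>}"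

text \<open>The empty collection has no dimension, hence the nonemptiness condition. It is
  automatic in the definition of shellability, where the complex in question always
  contains the empty face.\<close>

definition pure_of_dim :: "'a set set \<Rightarrow> int \<Rightarrow> bool" where
  "pure_of_dim \<Delta> d \<longleftrightarrow> \<Delta> \<noteq> {} \<and> (\<forall>\<sigma> \<in> facets \<Delta> {}. face_dim \<sigma> = d)"

text \<open>Positions in the list are counted from 0, so the first facet, which carries no
  condition when \<open>\<Gamma>\<close> is the empty collection, has index 0.\<close>

definition shellable :: "'a set set \<Rightarrow> 'a set set \<Rightarrow> bool" where
  "shellable \<Delta> \<Gamma> \<longleftrightarrow>
     (\<exists>\<sigma>s. distinct \<sigma>s \<and> set \<sigma>s = facets \<Delta> \<Gamma> \<and>
        (\<forall>j < length \<sigma>s. \<Gamma> \<noteq> {} \<or> j > 0 \<longrightarrow>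
           pure_of_dim
             (generated_complex {\<sigma>s ! j} \<inter> (\<Gamma> \<union> generated_complex (set (take j \<sigma>s))))
             (face_dim (\<sigma>s ! j) - 1)))"

end

theory Submission
  imports Defs
begin

text \<open>
  Write \<open>\<Gamma>' = (\<Delta>a \<inter> \<Delta>b) \<union> \<Gamma>b\<close>. The hypothesis \<open>\<Delta>a \<inter> \<Gamma>b \<subseteq> \<Gamma>a\<close> says that passing from
  \<open>\<Gamma>a\<close> to \<open>\<Gamma>a \<union> \<Gamma>b\<close> deletes no face of \<open>(\<Delta>a, \<Gamma>a)\<close>, while \<open>\<Gamma>'\<close> deletes from \<open>\<Delta>b\<close>, apart
  from \<open>\<Gamma>b\<close>, exactly what \<open>\<Delta>a\<close> already contains. So the faces of the glued complex
  are the disjoint union of the faces of the two pieces (\<open>faces_glue\<close>, \<open>faces_glue_disjoint\<close>).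
  A face of one piece that is properly contained in a face of the other is properly contained
  in a facet of the other, because complexes are finite; as no facet of one piece does this,
  the facets of the glued complex are those of the pieces (\<open>facets_Un\<close>). Hence two partitions
  into intervals can simply be put side by side (\<open>partitionable_Un\<close>).

  For shellability, list the facets of \<open>(\<Delta>a, \<Gamma>a)\<close> first and those of \<open>(\<Delta>b, \<Gamma>')\<close> next. The
  complex along which each facet is attached does not change. A facet \<open>\<sigma>\<close> of the first piece
  spans a subcomplex of \<open>\<Delta>a\<close>, where \<open>\<Gamma>b\<close> adds nothing to \<open>\<Gamma>a\<close>. Once all of the first piece
  is in place, \<open>\<Gamma>a\<close> and its facets make up the whole of \<open>\<Delta>a\<close>
  (\<open>relative_complex_eq_Un_generated\<close>), which inside \<open>\<Delta>b\<close> is the part \<open>\<Delta>a \<inter> \<Delta>b\<close> of \<open>\<Gamma>'\<close>.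
  What remains is to see that the exemption for the first facet of a non-relative complex
  is used at most once (\<open>shellable_glue\<close>).
\<close>

lemma simplicial_complex_Un:
  assumes "simplicial_complex \<Delta>" "simplicial_complex \<Gamma>"
  shows "simplicial_complex (\<Delta> \<union> \<Gamma>)"
proof -
  obtain V W where "finite V" "\<Delta> \<subseteq> Pow V" "finite W" "\<Gamma> \<subseteq> Pow W"
    using assms by (auto simp: simplicial_complex_def)
  then have "finite (V \<union> W) \<and> \<Delta> \<union> \<Gamma> \<subseteq> Pow (V \<union> W)" by auto
  moreover have "\<forall>\<sigma>\<in>\<Delta> \<union> \<Gamma>. \<forall>\<tau>. \<tau> \<subseteq> \<sigma> \<longrightarrow> \<tau> \<in> \<Delta> \<union> \<Gamma>"
    using assms unfolding simplicial_complex_def by blast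
  ultimately show ?thesis unfolding simplicial_complex_def by blast
qed

lemma simplicial_complex_finite: "simplicial_complex \<Delta> \<Longrightarrow> finite \<Delta>"
  unfolding simplicial_complex_def by (meson finite_Pow_iff finite_subset)

lemma simplicial_complex_down_closed:
  "simplicial_complex \<Delta> \<Longrightarrow> \<sigma> \<in> \<Delta> \<Longrightarrow> \<tau> \<subseteq> \<sigma> \<Longrightarrow> \<tau> \<in> \<Delta>"
  unfolding simplicial_complex_def by blast

lemma simplicial_complex_empty_face:
  "simplicial_complex \<Delta> \<Longrightarrow> \<Delta> \<noteq> {} \<Longrightarrow> {} \<in> \<Delta>"
  unfolding simplicial_complex_def by blast

lemma facets_subset_faces: "facets \<Delta> \<Gamma> \<subseteq> faces \<Delta> \<Gamma>"
  unfolding facets_def by blast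

lemma facets_in_complex: "\<sigma> \<in> facets \<Delta> \<Gamma> \<Longrightarrow> \<sigma> \<in> \<Delta>"
  unfolding facets_def faces_def by blast

lemma face_subset_facet:
  assumes "finite \<Delta>" "\<sigma> \<in> faces \<Delta> \<Gamma>"
  obtains \<tau> where "\<tau> \<in> facets \<Delta> \<Gamma>" "\<sigma> \<subseteq> \<tau>"
proof -
  have "finite (faces \<Delta> \<Gamma>)" using assms(1) by (simp add: faces_def)
  from finite_has_maximal2[OF this assms(2)] obtain \<tau>
    where "\<tau> \<in> faces \<Delta> \<Gamma>" "\<sigma> \<subseteq> \<tau>" "\<forall>\<rho> \<in> faces \<Delta> \<Gamma>. \<tau> \<subseteq> \<rho> \<longrightarrow> \<tau> = \<rho>" by blast
  then show thesis using that[of \<tau>] by (auto simp: facets_def)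
qed

lemma relative_complex_eq_Un_generated:
  assumes "relative_complex \<Delta> \<Gamma>"
  shows "\<Delta> = \<Gamma> \<union> generated_complex (facets \<Delta> \<Gamma>)"
proof
  have \<Delta>: "simplicial_complex \<Delta>" "\<Gamma> \<subseteq> \<Delta>" using assms by (auto simp: relative_complex_def)
  show "\<Delta> \<subseteq> \<Gamma> \<union> generated_complex (facets \<Delta> \<Gamma>)"
  proof
    fix \<sigma> assume "\<sigma> \<in> \<Delta>"
    show "\<sigma> \<in> \<Gamma> \<union> generated_complex (facets \<Delta> \<Gamma>)"
    proof (cases "\<sigma> \<in> \<Gamma>")
      case False
      then have "\<sigma> \<in> faces \<Delta> \<Gamma>" using \<open>\<sigma> \<in> \<Delta>\<close> by (simp add: faces_def)
      then obtain \<tau> where "\<tau> \<in> facets \<Delta> \<Gamma>" "\<sigma> \<subseteq> \<tau>"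
        by (rule face_subset_facet[OF simplicial_complex_finite[OF \<Delta>(1)]])
      then show ?thesis by (auto simp: generated_complex_def)
    qed simp
  qed
  show "\<Gamma> \<union> generated_complex (facets \<Delta> \<Gamma>) \<subseteq> \<Delta>"
    using \<Delta> facets_in_complex simplicial_complex_down_closed
    unfolding generated_complex_def by blast
qed

lemma faces_glue:
  assumes "\<Gamma>a \<subseteq> \<Delta>a" "\<Delta>a \<inter> \<Gamma>b \<subseteq> \<Gamma>a"
  shows "faces (\<Delta>a \<union> \<Delta>b) (\<Gamma>a \<union> \<Gamma>b)
           = faces \<Delta>a \<Gamma>a \<union> faces \<Delta>b ((\<Delta>a \<inter> \<Delta>b) \<union> \<Gamma>b)"
  using assms unfolding faces_def by blast

lemma faces_glue_disjoint: "faces \<Delta>a \<Gamma>a \<inter> faces \<Delta>b ((\<Delta>a \<inter> \<Delta>b) \<union> \<Gamma>b) = {}"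
  unfolding faces_def by blast

lemma face_not_above:
  assumes "finite \<Delta>" "\<rho> \<in> faces \<Delta> \<Gamma>" "\<forall>\<tau> \<in> facets \<Delta> \<Gamma>. \<not> \<sigma> \<subset> \<tau>"
  shows "\<not> \<sigma> \<subset> \<rho>"
proof
  assume "\<sigma> \<subset> \<rho>"
  obtain \<tau> where \<tau>: "\<tau> \<in> facets \<Delta> \<Gamma>" "\<rho> \<subseteq> \<tau>"
    by (rule face_subset_facet[OF assms(1,2)])
  show False
    using psubset_subset_trans[OF \<open>\<sigma> \<subset> \<rho>\<close> \<tau>(2)] assms(3) \<tau>(1) by simp
qed

text \<open>Being a facet is maximality among all faces of the union, but it suffices to exclude
  inclusions between facets: a larger face of the other piece lies in a facet of that piece.\<close>

lemma facets_Un: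
  assumes "finite \<Delta>a" "finite \<Delta>b"
    and faces: "faces \<Delta> \<Gamma> = faces \<Delta>a \<Gamma>a \<union> faces \<Delta>b \<Gamma>b"
    and incomparable: "\<forall>\<sigma> \<in> facets \<Delta>a \<Gamma>a. \<forall>\<tau> \<in> facets \<Delta>b \<Gamma>b. \<not> \<sigma> \<subset> \<tau> \<and> \<not> \<tau> \<subset> \<sigma>"
  shows "facets \<Delta> \<Gamma> = facets \<Delta>a \<Gamma>a \<union> facets \<Delta>b \<Gamma>b"
proof
  show "facets \<Delta> \<Gamma> \<subseteq> facets \<Delta>a \<Gamma>a \<union> facets \<Delta>b \<Gamma>b"
    unfolding facets_def faces by blast
  have "\<not> \<sigma> \<subset> \<rho>" if "\<sigma> \<in> facets \<Delta>a \<Gamma>a" "\<rho> \<in> faces \<Delta>b \<Gamma>b" for \<sigma> \<rho>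
    using face_not_above[OF \<open>finite \<Delta>b\<close> that(2)] incomparable that(1) by simp
  moreover have "\<not> \<tau> \<subset> \<rho>" if "\<tau> \<in> facets \<Delta>b \<Gamma>b" "\<rho> \<in> faces \<Delta>a \<Gamma>a" for \<tau> \<rho>
    using face_not_above[OF \<open>finite \<Delta>a\<close> that(2)] incomparable that(1) by simp
  ultimately show "facets \<Delta>a \<Gamma>a \<union> facets \<Delta>b \<Gamma>b \<subseteq> facets \<Delta> \<Gamma>"
    unfolding facets_def faces by blast
qed

text \<open>Each interval consists of faces of its own piece, so intervals from different pieces
  cannot meet.\<close>

lemma partitionable_Un:
  assumes "partitionable \<Delta>a \<Gamma>a" "partitionable \<Delta>b \<Gamma>b"
    and faces: "faces \<Delta> \<Gamma> = faces \<Delta>a \<Gamma>a \<union> faces \<Delta>b \<Gamma>b"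
    and disjoint: "faces \<Delta>a \<Gamma>a \<inter> faces \<Delta>b \<Gamma>b = {}"
    and facets: "facets \<Delta> \<Gamma> = facets \<Delta>a \<Gamma>a \<union> facets \<Delta>b \<Gamma>b"
  shows "partitionable \<Delta> \<Gamma>"
proof -
  obtain Ra where Ra: "\<forall>\<sigma> \<in> facets \<Delta>a \<Gamma>a. Ra \<sigma> \<subseteq> \<sigma> \<and> Ra \<sigma> \<in> faces \<Delta>a \<Gamma>a"
    "disjoint_family_on (\<lambda>\<sigma>. {Ra \<sigma>..\<sigma>}) (facets \<Delta>a \<Gamma>a)"
    "faces \<Delta>a \<Gamma>a = (\<Union>\<sigma> \<in> facets \<Delta>a \<Gamma>a. {Ra \<sigma>..\<sigma>})"
    using assms(1) unfolding partitionable_def by blast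
  obtain Rb where Rb: "\<forall>\<sigma> \<in> facets \<Delta>b \<Gamma>b. Rb \<sigma> \<subseteq> \<sigma> \<and> Rb \<sigma> \<in> faces \<Delta>b \<Gamma>b"
    "disjoint_family_on (\<lambda>\<sigma>. {Rb \<sigma>..\<sigma>}) (facets \<Delta>b \<Gamma>b)"
    "faces \<Delta>b \<Gamma>b = (\<Union>\<sigma> \<in> facets \<Delta>b \<Gamma>b. {Rb \<sigma>..\<sigma>})"
    using assms(2) unfolding partitionable_def by blast
  define R where "R \<sigma> = (if \<sigma> \<in> facets \<Delta>a \<Gamma>a then Ra \<sigma> else Rb \<sigma>)" for \<sigma>
  have R_a: "R \<sigma> = Ra \<sigma>" if "\<sigma> \<in> facets \<Delta>a \<Gamma>a" for \<sigma>
    using that by (simp add: R_def)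
  have R_b: "R \<sigma> = Rb \<sigma>" if "\<sigma> \<in> facets \<Delta>b \<Gamma>b" for \<sigma>
  proof -
    have "\<sigma> \<notin> facets \<Delta>a \<Gamma>a"
      using that disjoint facets_subset_faces[of \<Delta>a \<Gamma>a] facets_subset_faces[of \<Delta>b \<Gamma>b] by blast
    then show ?thesis by (simp add: R_def)
  qed
  have in_a: "{R \<sigma>..\<sigma>} \<subseteq> faces \<Delta>a \<Gamma>a" if "\<sigma> \<in> facets \<Delta>a \<Gamma>a" for \<sigma>
    using that R_a Ra(3) by auto
  have in_b: "{R \<sigma>..\<sigma>} \<subseteq> faces \<Delta>b \<Gamma>b" if "\<sigma> \<in> facets \<Delta>b \<Gamma>b" for \<sigma>
    using that R_b Rb(3) by auto
  have "\<forall>\<sigma> \<in> facets \<Delta> \<Gamma>. R \<sigma> \<subseteq> \<sigma> \<and> R \<sigma> \<in> faces \<Delta> \<Gamma>"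
    using Ra(1) Rb(1) unfolding facets faces by (simp add: ball_Un R_a R_b)
  moreover have "disjoint_family_on (\<lambda>\<sigma>. {R \<sigma>..\<sigma>}) (facets \<Delta> \<Gamma>)"
    unfolding disjoint_family_on_def
  proof (intro ballI impI)
    fix \<sigma> \<tau> assume "\<sigma> \<in> facets \<Delta> \<Gamma>" "\<tau> \<in> facets \<Delta> \<Gamma>" and ne: "\<sigma> \<noteq> \<tau>"
    then consider "\<sigma> \<in> facets \<Delta>a \<Gamma>a" "\<tau> \<in> facets \<Delta>a \<Gamma>a" | "\<sigma> \<in> facets \<Delta>b \<Gamma>b" "\<tau> \<in> facets \<Delta>b \<Gamma>b"
      | "\<sigma> \<in> facets \<Delta>a \<Gamma>a" "\<tau> \<in> facets \<Delta>b \<Gamma>b" | "\<sigma> \<in> facets \<Delta>b \<Gamma>b" "\<tau> \<in> facets \<Delta>a \<Gamma>a"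
      unfolding facets by blast
    then show "{R \<sigma>..\<sigma>} \<inter> {R \<tau>..\<tau>} = {}"
    proof cases
      case 1
      show ?thesis
        unfolding R_a[OF 1(1)] R_a[OF 1(2)] by (rule disjoint_family_onD[OF Ra(2) 1 ne])
    next
      case 2
      show ?thesis
        unfolding R_b[OF 2(1)] R_b[OF 2(2)] by (rule disjoint_family_onD[OF Rb(2) 2 ne])
    next
      case 3
      show ?thesis using in_a[OF 3(1)] in_b[OF 3(2)] disjoint by blast
    next
      case 4
      show ?thesis using in_b[OF 4(1)] in_a[OF 4(2)] disjoint by blast
    qed
  qed
  moreover have "faces \<Delta> \<Gamma> = (\<Union>\<sigma> \<in> facets \<Delta> \<Gamma>. {R \<sigma>..\<sigma>})"
    unfolding faces facets UN_Un Ra(3) Rb(3) using R_a R_b by auto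
  ultimately show ?thesis unfolding partitionable_def by blast
qed

text \<open>Concatenated shellings attach each facet along the same complex as before. The only
  other difference between the purity conditions is when the first facet of a list is exempt:
  a facet of either piece that is exempt there must be exempt in the concatenation too. This
  holds because a nonempty complex contains the empty face, so nonempty complexes always
  meet.\<close>

lemma shellable_glue:
  assumes rel_a: "relative_complex \<Delta>a \<Gamma>a" and rel_b: "relative_complex \<Delta>b \<Gamma>b"
    and sub: "\<Delta>a \<inter> \<Gamma>b \<subseteq> \<Gamma>a"
    and facets: "facets (\<Delta>a \<union> \<Delta>b) (\<Gamma>a \<union> \<Gamma>b)
                   = facets \<Delta>a \<Gamma>a \<union> facets \<Delta>b ((\<Delta>a \<inter> \<Delta>b) \<union> \<Gamma>b)"
    and "shellable \<Delta>a \<Gamma>a" "shellable \<Delta>b ((\<Delta>a \<inter> \<Delta>b) \<union> \<Gamma>b)"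
  shows "shellable (\<Delta>a \<union> \<Delta>b) (\<Gamma>a \<union> \<Gamma>b)"
proof -
  let ?\<Gamma>' = "(\<Delta>a \<inter> \<Delta>b) \<union> \<Gamma>b"
  have cpx: "simplicial_complex \<Delta>a" "simplicial_complex \<Delta>b" "simplicial_complex \<Gamma>b"
    and "\<Gamma>a \<subseteq> \<Delta>a"
    using rel_a rel_b by (auto simp: relative_complex_def)
  obtain as where as: "distinct as" "set as = facets \<Delta>a \<Gamma>a"
    and shell_a: "\<And>j. j < length as \<Longrightarrow> \<Gamma>a \<noteq> {} \<or> j > 0 \<Longrightarrow>
      pure_of_dim (generated_complex {as ! j} \<inter> (\<Gamma>a \<union> generated_complex (set (take j as))))
        (face_dim (as ! j) - 1)"
    using assms(5) unfolding shellable_def by blast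
  obtain bs where bs: "distinct bs" "set bs = facets \<Delta>b ?\<Gamma>'"
    and shell_b: "\<And>j. j < length bs \<Longrightarrow> ?\<Gamma>' \<noteq> {} \<or> j > 0 \<Longrightarrow>
      pure_of_dim (generated_complex {bs ! j} \<inter> (?\<Gamma>' \<union> generated_complex (set (take j bs))))
        (face_dim (bs ! j) - 1)"
    using assms(6) unfolding shellable_def by blast
  have "set as \<inter> set bs = {}"
    unfolding as(2) bs(2) using faces_glue_disjoint facets_subset_faces by blast
  then have "distinct (as @ bs)" using as(1) bs(1) by simp
  moreover have "set (as @ bs) = facets (\<Delta>a \<union> \<Delta>b) (\<Gamma>a \<union> \<Gamma>b)"
    using as(2) bs(2) facets by simp
  moreover have "pure_of_dim
      (generated_complex {(as @ bs) ! j} \<inter>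
        (\<Gamma>a \<union> \<Gamma>b \<union> generated_complex (set (take j (as @ bs)))))
      (face_dim ((as @ bs) ! j) - 1)"
    if j: "j < length (as @ bs)" and conditioned: "\<Gamma>a \<union> \<Gamma>b \<noteq> {} \<or> j > 0" for j
  proof (cases "j < length as")
    case True
    have "as ! j \<in> \<Delta>a"
      using True as(2) facets_in_complex nth_mem by metis
    then have "generated_complex {as ! j} \<subseteq> \<Delta>a"
      using simplicial_complex_down_closed[OF cpx(1)] by (auto simp: generated_complex_def)
    then have "generated_complex {as ! j} \<inter> (\<Gamma>a \<union> \<Gamma>b \<union> generated_complex (set (take j as)))
        = generated_complex {as ! j} \<inter> (\<Gamma>a \<union> generated_complex (set (take j as)))"
      using sub by blast
    \<comment> \<open>Since \<open>\<Delta>a\<close> has a facet, it contains the empty face; if \<open>\<Gamma>b\<close> is nonempty, then the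
      empty face also lies in \<open>\<Gamma>b\<close> and hence in \<open>\<Gamma>a\<close>.\<close>
    moreover have "\<Gamma>a \<noteq> {} \<or> j > 0"
      using conditioned sub simplicial_complex_down_closed[OF cpx(1) \<open>as ! j \<in> \<Delta>a\<close>, of "{}"]
        simplicial_complex_empty_face[OF cpx(3)]
      by auto
    ultimately show ?thesis
      using shell_a[OF True] True by (simp add: nth_append)
  next
    case False
    define i where "i = j - length as"
    have i: "i < length bs" "(as @ bs) ! j = bs ! i" "set (take j (as @ bs)) = set as \<union> set (take i bs)"
      using False j by (auto simp: i_def nth_append)
    have "bs ! i \<in> \<Delta>b"
      using i(1) bs(2) facets_in_complex nth_mem by metis
    then have in_b: "generated_complex {bs ! i} \<subseteq> \<Delta>b"
      using simplicial_complex_down_closed[OF cpx(2)] by (auto simp: generated_complex_def)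
    have "generated_complex (set as \<union> set (take i bs))
        = generated_complex (facets \<Delta>a \<Gamma>a) \<union> generated_complex (set (take i bs))"
      unfolding as(2) generated_complex_def by blast
    then have "\<Gamma>a \<union> \<Gamma>b \<union> generated_complex (set as \<union> set (take i bs))
        = \<Delta>a \<union> \<Gamma>b \<union> generated_complex (set (take i bs))"
      using relative_complex_eq_Un_generated[OF rel_a] by blast
    then have "generated_complex {bs ! i} \<inter>
          (\<Gamma>a \<union> \<Gamma>b \<union> generated_complex (set as \<union> set (take i bs)))
        = generated_complex {bs ! i} \<inter> (?\<Gamma>' \<union> generated_complex (set (take i bs)))"
      using in_b by blast
    \<comment> \<open>A first facet of the second piece that carries a condition because of \<open>\<Gamma>a\<close> or of an
      earlier facet finds \<open>\<Delta>a\<close> nonempty; the empty face then lies in \<open>\<Delta>a \<inter> \<Delta>b\<close>.\<close>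
    moreover have "?\<Gamma>' \<noteq> {} \<or> i > 0"
    proof (rule ccontr)
      assume "\<not> (?\<Gamma>' \<noteq> {} \<or> i > 0)"
      then have empty: "\<Delta>a \<inter> \<Delta>b = {}" "\<Gamma>b = {}" "j = length as"
        using False by (auto simp: i_def)
      then have "\<Gamma>a \<noteq> {} \<or> facets \<Delta>a \<Gamma>a \<noteq> {}"
        using conditioned as(2) by auto
      then have "\<Delta>a \<noteq> {}"
        using \<open>\<Gamma>a \<subseteq> \<Delta>a\<close> facets_in_complex by blast
      then show False
        using empty(1) simplicial_complex_empty_face[OF cpx(1)]
          simplicial_complex_down_closed[OF cpx(2) \<open>bs ! i \<in> \<Delta>b\<close>, of "{}"] by auto
    qed
    ultimately show ?thesis
      using shell_b[OF i(1)] by (simp only: i(2,3))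
  qed
  ultimately show ?thesis unfolding shellable_def by blast
qed

theorem lemma3p4:
  fixes \<Delta>a \<Gamma>a \<Delta>b \<Gamma>b :: "'a set set"
  assumes "relative_complex \<Delta>a \<Gamma>a"
    and "relative_complex \<Delta>b \<Gamma>b"
    and "relative_complex \<Delta>b ((\<Delta>a \<inter> \<Delta>b) \<union> \<Gamma>b)"
    and "partitionable \<Delta>a \<Gamma>a"
    and "partitionable \<Delta>b ((\<Delta>a \<inter> \<Delta>b) \<union> \<Gamma>b)"
    and "\<forall>\<sigma> \<in> facets \<Delta>a \<Gamma>a. \<forall>\<tau> \<in> facets \<Delta>b ((\<Delta>a \<inter> \<Delta>b) \<union> \<Gamma>b).
           \<not> \<sigma> \<subset> \<tau> \<and> \<not> \<tau> \<subset> \<sigma>"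
    and "\<Delta>a \<inter> \<Gamma>b \<subseteq> \<Gamma>a"
  shows "relative_complex (\<Delta>a \<union> \<Delta>b) (\<Gamma>a \<union> \<Gamma>b) \<and>
         partitionable (\<Delta>a \<union> \<Delta>b) (\<Gamma>a \<union> \<Gamma>b) \<and>
         (shellable \<Delta>a \<Gamma>a \<and> shellable \<Delta>b ((\<Delta>a \<inter> \<Delta>b) \<union> \<Gamma>b) \<longrightarrow>
            shellable (\<Delta>a \<union> \<Delta>b) (\<Gamma>a \<union> \<Gamma>b))"
proof -
  have cpx: "simplicial_complex \<Delta>a" "simplicial_complex \<Delta>b" "simplicial_complex \<Gamma>a"
      "simplicial_complex \<Gamma>b" "\<Gamma>a \<subseteq> \<Delta>a" "\<Gamma>b \<subseteq> \<Delta>b"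
    using assms(1,2) by (auto simp: relative_complex_def)
  have rel: "relative_complex (\<Delta>a \<union> \<Delta>b) (\<Gamma>a \<union> \<Gamma>b)"
    using cpx simplicial_complex_Un unfolding relative_complex_def by blast
  note faces = faces_glue[OF cpx(5) assms(7)]
  note facets = facets_Un[OF simplicial_complex_finite[OF cpx(1)]
      simplicial_complex_finite[OF cpx(2)] faces assms(6)]
  have part: "partitionable (\<Delta>a \<union> \<Delta>b) (\<Gamma>a \<union> \<Gamma>b)"
    by (rule partitionable_Un[OF assms(4,5) faces faces_glue_disjoint facets])
  have "shellable (\<Delta>a \<union> \<Delta>b) (\<Gamma>a \<union> \<Gamma>b)"
    if "shellable \<Delta>a \<Gamma>a" "shellable \<Delta>b ((\<Delta>a \<inter> \<Delta>b) \<union> \<Gamma>b)"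
    using shellable_glue[OF assms(1,2,7) facets that] .
  with rel part show ?thesis by blast
qed

end
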